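(* Let $\gamma>0$, let $n$ be a positive integer, let $g_1,\dots,g_n\in\mathcal{H}_\gamma(\mathbb{D})$ be arbitrary, and let $T_n$ be the finite-rank operator on $\mathcal{H}_\gamma(\mathbb{D})$ given by $T_n(f)=\sum_{i=1}^{n}\langle f,g_i\rangle g_i$ for $f\in\mathcal{H}_\gamma(\mathbb{D})$. Then the Berezin range $\mathrm{Ber}(T_n)$ is convex in $\mathbb{C}$.
   Context: $\mathbb{D}$ is the open unit disc in $\mathbb{C}$. For $\gamma>0$, $\mathcal{H}_\gamma(\mathbb{D})$ is the reproducing kernel Hilbert space of holomorphic functions on $\mathbb{D}$ with reproducing kernel $k_\lambda(z)=(1-\overline{\lambda}z)^{-\gamma}$ for $\lambda,z\in\mathbb{D}$ (principal branch), so $\langle f,k_\lambda\rangle=f(\lambda)$ and $\|k_\lambda\|^2=(1-|\lambda|^2)^{-\gamma}$. Put $\widehat{k}_\lambda=k_\lambda/\|k_\lambda\|$. For a bounded linear operator $T$ on $\mathcal{H}_\gamma(\mathbb{D})$, the Berezin transform is $\widetilde{T}(\lambda)=\langle T\widehat{k}_\lambda,\widehat{k}_\lambda\rangle$ for $\lambda\in\mathbb{D}$, and the Berezin range is $\mathrm{Ber}(T)=\{\widetilde{T}(\lambda):\lambda\in\mathbb{D}\}\subseteq\mathbb{C}$. *)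

theory Defs
  imports "HOL-Analysis.Analysis"
begin

text \<open>
  A complex Hilbert space whose elements are complex-valued functions on \<open>X\<close>, with pointwise
  operations. HOL functions are total, so a function on \<open>X\<close> is represented by its extension by
  zero; this makes equality in \<open>H\<close> coincide with equality on \<open>X\<close>.
  The inner product \<open>ip\<close> is linear in its first argument.
\<close>

definition ip_norm :: "(('a \<Rightarrow> complex) \<Rightarrow> ('a \<Rightarrow> complex) \<Rightarrow> complex) \<Rightarrow> ('a \<Rightarrow> complex) \<Rightarrow> real"
  where "ip_norm ip f = sqrt (Re (ip f f))"

locale function_hilbert_space =
  fixes X :: "'a set"
    and H :: "('a \<Rightarrow> complex) set"
    and ip :: "('a \<Rightarrow> complex) \<Rightarrow> ('a \<Rightarrow> complex) \<Rightarrow> complex"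
  assumes zero_outside: "f \<in> H \<Longrightarrow> x \<notin> X \<Longrightarrow> f x = 0"
    and zero_mem: "(\<lambda>x. 0) \<in> H"
    and add_mem: "f \<in> H \<Longrightarrow> g \<in> H \<Longrightarrow> (\<lambda>x. f x + g x) \<in> H"
    and scale_mem: "f \<in> H \<Longrightarrow> (\<lambda>x. c * f x) \<in> H"
    and ip_add_left: "f \<in> H \<Longrightarrow> g \<in> H \<Longrightarrow> h \<in> H \<Longrightarrow> ip (\<lambda>x. f x + g x) h = ip f h + ip g h"
    and ip_scale_left: "f \<in> H \<Longrightarrow> g \<in> H \<Longrightarrow> ip (\<lambda>x. c * f x) g = c * ip f g"
    and ip_commute: "f \<in> H \<Longrightarrow> g \<in> H \<Longrightarrow> ip g f = cnj (ip f g)"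
    and ip_pos: "f \<in> H \<Longrightarrow> f \<noteq> (\<lambda>x. 0) \<Longrightarrow> Re (ip f f) > 0"
    and complete:
      "\<lbrakk>\<And>n. s n \<in> H;
        \<And>e. e > 0 \<Longrightarrow> \<exists>N. \<forall>m\<ge>N. \<forall>n\<ge>N. ip_norm ip (\<lambda>x. s m x - s n x) < e\<rbrakk>
       \<Longrightarrow> \<exists>f\<in>H. (\<lambda>n::nat. ip_norm ip (\<lambda>x. s n x - f x)) \<longlonglongrightarrow> 0"

text \<open>
  Kernels are curried with the parameter first: \<open>k w\<close> is the kernel function at \<open>w\<close>.
  By the Moore--Aronszajn theorem the pair \<open>H\<close>, \<open>ip\<close> is determined by the kernel
  (\<open>ip\<close> of course only on \<open>H\<close>).
\<close>

locale rkhs = function_hilbert_space X H ip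
  for X :: "'a set"
    and H :: "('a \<Rightarrow> complex) set"
    and ip :: "('a \<Rightarrow> complex) \<Rightarrow> ('a \<Rightarrow> complex) \<Rightarrow> complex" +
  fixes k :: "'a \<Rightarrow> 'a \<Rightarrow> complex"
  assumes kernel_mem: "w \<in> X \<Longrightarrow> k w \<in> H"
    and reproducing: "f \<in> H \<Longrightarrow> w \<in> X \<Longrightarrow> ip f (k w) = f w"

definition normalized_kernel ::
    "(('a \<Rightarrow> complex) \<Rightarrow> ('a \<Rightarrow> complex) \<Rightarrow> complex) \<Rightarrow> ('a \<Rightarrow> 'a \<Rightarrow> complex) \<Rightarrow> 'a \<Rightarrow> 'a \<Rightarrow> complex"
  where "normalized_kernel ip k w = (\<lambda>z. k w z / complex_of_real (ip_norm ip (k w)))"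

definition berezin_transform ::
    "(('a \<Rightarrow> complex) \<Rightarrow> ('a \<Rightarrow> complex) \<Rightarrow> complex) \<Rightarrow> ('a \<Rightarrow> 'a \<Rightarrow> complex)
      \<Rightarrow> (('a \<Rightarrow> complex) \<Rightarrow> ('a \<Rightarrow> complex)) \<Rightarrow> 'a \<Rightarrow> complex"
  where "berezin_transform ip k T w =
    ip (T (normalized_kernel ip k w)) (normalized_kernel ip k w)"

definition berezin_range ::
    "'a set \<Rightarrow> (('a \<Rightarrow> complex) \<Rightarrow> ('a \<Rightarrow> complex) \<Rightarrow> complex) \<Rightarrow> ('a \<Rightarrow> 'a \<Rightarrow> complex)
      \<Rightarrow> (('a \<Rightarrow> complex) \<Rightarrow> ('a \<Rightarrow> complex)) \<Rightarrow> complex set"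
  where "berezin_range X ip k T = berezin_transform ip k T ` X"

text \<open>
  The base \<open>1 - cnj w * z\<close> has positive real part for \<open>w\<close>, \<open>z\<close> in the unit disc, and complex
  \<open>powr\<close> is defined through the principal logarithm, so this is the principal branch.
\<close>

definition disc_kernel :: "real \<Rightarrow> complex \<Rightarrow> complex \<Rightarrow> complex"
  where "disc_kernel \<gamma> w z =
    (if z \<in> ball 0 1 then (1 - cnj w * z) powr complex_of_real (- \<gamma>) else 0)"

locale disc_space = rkhs "ball 0 1" H ip "disc_kernel \<gamma>"
  for \<gamma> :: real
    and H :: "(complex \<Rightarrow> complex) set"
    and ip :: "(complex \<Rightarrow> complex) \<Rightarrow> (complex \<Rightarrow> complex) \<Rightarrow> complex" +
  assumes holomorphic: "f \<in> H \<Longrightarrow> f holomorphic_on ball 0 1"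

end

theory Submission
  imports Defs
begin

text \<open>
  The Berezin transform of \<open>T\<^sub>n\<close> at \<open>w\<close> is \<open>(1 - |w|\<^sup>2)\<^sup>\<gamma> \<Sum>i. |g\<^sub>i(w)|\<^sup>2\<close>, a continuous real-valued
  function on the connected disc, so the Berezin range is an interval of the real line.
\<close>

context function_hilbert_space
begin

lemma ip_scale_right:
  assumes "f \<in> H" "h \<in> H"
  shows "ip f (\<lambda>x. c * h x) = cnj c * ip f h"
  using assms by (metis complex_cnj_mult ip_commute ip_scale_left scale_mem)

lemma ip_zero_left: "f \<in> H \<Longrightarrow> ip (\<lambda>x. 0) f = 0"
  using ip_scale_left[of "\<lambda>x. 0" f 0] zero_mem by simp

lemma ip_self_nonneg: "f \<in> H \<Longrightarrow> Re (ip f f) \<ge> 0"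
  using ip_pos[of f] ip_zero_left[OF zero_mem] by (cases "f = (\<lambda>x. 0)") auto

lemma sum_mem:
  assumes "\<And>i. i \<in> A \<Longrightarrow> f i \<in> H"
  shows "(\<lambda>x. \<Sum>i\<in>A. f i x) \<in> H"
  \<comment> \<open>A sum over an infinite \<open>A\<close> is 0 by convention, so that case, like
    the empty one, comes down to \<open>zero_mem\<close>.\<close>
  using assms by (induction A rule: infinite_finite_induct) (auto intro: zero_mem add_mem)

lemma ip_sum_left:
  assumes "\<And>i. i \<in> A \<Longrightarrow> f i \<in> H" "h \<in> H"
  shows "ip (\<lambda>x. \<Sum>i\<in>A. f i x) h = (\<Sum>i\<in>A. ip (f i) h)"
  using assms
  by (induction A rule: infinite_finite_induct) (auto simp: ip_zero_left ip_add_left sum_mem)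

end

context rkhs
begin

lemma normalized_kernel_mem: "w \<in> X \<Longrightarrow> normalized_kernel ip k w \<in> H"
  using scale_mem[OF kernel_mem, of w "1 / complex_of_real (ip_norm ip (k w))"]
  by (simp add: normalized_kernel_def)

text \<open>The reproducing property, rescaled: the normalizing factor is real, so conjugating it in
  the second argument changes nothing.\<close>

lemma ip_normalized_kernel:
  assumes "f \<in> H" "w \<in> X"
  shows "ip f (normalized_kernel ip k w) = f w / complex_of_real (ip_norm ip (k w))"
  using ip_scale_right[OF assms(1) kernel_mem[OF assms(2)],
      of "1 / complex_of_real (ip_norm ip (k w))"] assms
  by (simp add: normalized_kernel_def reproducing)

lemma ip_norm_kernel_power2: "w \<in> X \<Longrightarrow> (ip_norm ip (k w))\<^sup>2 = Re (k w w)"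
  using ip_self_nonneg[OF kernel_mem] by (simp add: ip_norm_def kernel_mem reproducing)

text \<open>With \<open>u\<close> the normalized kernel at \<open>w\<close>, each rank-one term
  contributes \<open>|ip (g i) u|^2\<close>, and the reproducing property evaluates
  \<open>ip (g i) u\<close>. If \<open>k w w\<close> is 0, both sides vanish, since division by 0
  gives 0.\<close>

lemma berezin_transform_sum_rank_one:
  assumes g: "\<And>i. i \<in> A \<Longrightarrow> g i \<in> H"
    and T: "\<And>f. f \<in> H \<Longrightarrow> T f = (\<lambda>z. \<Sum>i\<in>A. ip f (g i) * g i z)"
    and w: "w \<in> X"
  shows "berezin_transform ip k T w = complex_of_real ((\<Sum>i\<in>A. (cmod (g i w))\<^sup>2) / Re (k w w))"
proof -
  let ?N = "ip_norm ip (k w)" and ?u = "normalized_kernel ip k w"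
  \<comment> \<open>\<open>T\<close> is specified only on \<open>H\<close>, so its formula applies
    to \<open>?u\<close> only after this.\<close>
  have u: "?u \<in> H"
    using w by (rule normalized_kernel_mem)
  have "berezin_transform ip k T w = (\<Sum>i\<in>A. ip ?u (g i) * ip (g i) ?u)"
    unfolding berezin_transform_def T[OF u]
    by (subst ip_sum_left) (auto intro!: scale_mem g u sum.cong simp: ip_scale_left g u)
  also have "\<dots> = (\<Sum>i\<in>A. complex_of_real ((cmod (g i w))\<^sup>2 / ?N\<^sup>2))"
  proof (rule sum.cong[OF refl])
    fix i assume "i \<in> A"
    then have "ip ?u (g i) = cnj (g i w / complex_of_real ?N)"
      and "ip (g i) ?u = g i w / complex_of_real ?N"
      by (metis g u w ip_commute ip_normalized_kernel, metis g w ip_normalized_kernel)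
    then show "ip ?u (g i) * ip (g i) ?u = complex_of_real ((cmod (g i w))\<^sup>2 / ?N\<^sup>2)"
      unfolding of_real_divide complex_norm_square by (simp add: power2_eq_square)
  qed
  finally show ?thesis
    by (simp add: ip_norm_kernel_power2[OF w] sum_divide_distrib)
qed

end

text \<open>On the diagonal the base is real and nonnegative, where the principal complex power
  agrees with the real one.\<close>

lemma disc_kernel_diagonal:
  assumes "w \<in> ball 0 1"
  shows "disc_kernel \<gamma> w w = complex_of_real ((1 - (cmod w)\<^sup>2) powr (- \<gamma>))"
proof -
  have "1 - cnj w * w = complex_of_real (1 - (cmod w)\<^sup>2)"
    by (simp only: of_real_diff complex_norm_square of_real_1 mult.commute)
  moreover have "(cmod w)\<^sup>2 \<le> 1"
    using assms by (simp add: power_le_one)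
  ultimately show ?thesis
    using assms powr_of_real[of "1 - (cmod w)\<^sup>2" "- \<gamma>"] by (simp add: disc_kernel_def)
qed

theorem theorem3p5:
  fixes \<gamma> :: real
    and H :: "(complex \<Rightarrow> complex) set"
    and ip :: "(complex \<Rightarrow> complex) \<Rightarrow> (complex \<Rightarrow> complex) \<Rightarrow> complex"
    and n :: nat
    and g :: "nat \<Rightarrow> complex \<Rightarrow> complex"
    and T :: "(complex \<Rightarrow> complex) \<Rightarrow> (complex \<Rightarrow> complex)"
  assumes "\<gamma> > 0"
    and "disc_space \<gamma> H ip"
    and "n \<ge> 1"
    and "\<And>i. i \<in> {1..n} \<Longrightarrow> g i \<in> H"
    and "\<And>f. f \<in> H \<Longrightarrow> T f = (\<lambda>z. \<Sum>i=1..n. ip f (g i) * g i z)"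
  shows "convex (berezin_range (ball 0 1) ip (disc_kernel \<gamma>) T)"
proof -
  interpret disc_space \<gamma> H ip by fact
  define h where "h w = (\<Sum>i=1..n. (cmod (g i w))\<^sup>2) / (1 - (cmod w)\<^sup>2) powr (- \<gamma>)" for w
  have "berezin_transform ip (disc_kernel \<gamma>) T w = complex_of_real (h w)" if "w \<in> ball 0 1" for w
    using berezin_transform_sum_rank_one[of "{1..n}" g T, OF assms(4,5) that]
    by (simp only: h_def disc_kernel_diagonal[OF that] Re_complex_of_real)
  then have range: "berezin_range (ball 0 1) ip (disc_kernel \<gamma>) T = of_real ` h ` ball 0 1"
    by (simp add: berezin_range_def image_image)
  have "continuous_on (ball 0 1) (g i)" if "i \<in> {1..n}" for i
    using holomorphic[OF assms(4)[OF that]] by (rule holomorphic_on_imp_continuous_on)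
  \<comment> \<open>A nonzero base serves twice: it makes the real power continuous and keeps the
    denominator of \<open>h\<close> away from 0.\<close>
  moreover have "1 - (cmod w)\<^sup>2 \<noteq> 0" if "w \<in> ball 0 1" for w
    using that abs_square_less_1[of "cmod w"] by auto
  ultimately have "continuous_on (ball 0 1) h"
    unfolding h_def by (intro continuous_intros) auto
  \<comment> \<open>For subsets of the real line, convex and connected coincide, and the disc is
    connected because it is convex.\<close>
  then have "convex (h ` ball 0 1)"
    by (intro connected_convex_1[THEN iffD1] connected_continuous_image convex_connected convex_ball)
       auto
  then show ?thesis
    \<comment> \<open>The embedding of the reals into the complex plane is real-linear, so it
      carries the interval to a convex set.\<close>
    unfolding range by (rule convex_linear_image[OF linear_of_real])
qed

end
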